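(* Let $\mathcal{H}$ be a Hilbert space and let $f,g:\mathcal{H}\to\mathbb{R}\cup\{+\infty\}$ be two proper lower semicontinuous convex functions such that (i) $s_f(x)=s_g(x)$ for all $x\in\mathcal{H}$; (ii) $p_f=p_g$; and (iii) $p_f\in\partial f(\mathcal{H})$. Then $f$ and $g$ are equal up to an additive constant, i.e. there exists $c\in\mathbb{R}$ with $f=g+c$ on $\mathcal{H}$ (with the convention $+\infty+c=+\infty$).
   Context: $\mathcal{H}$ is a real Hilbert space with norm $\|\cdot\|$. For a proper lower semicontinuous convex $f$, $\partial f$ is the convex subdifferential and $\partial f(\mathcal{H})=\bigcup_{x\in\mathcal{H}}\partial f(x)$; its closure is convex. The Crandall-Pazy direction of $f$ is $p_f:=\mathrm{proj}_{\overline{\partial f(\mathcal{H})}}(0)$, the unique element of minimal norm of $\overline{\partial f(\mathcal{H})}$. The slope of $f$ is $s_f(x)=\limsup_{y\to x}\frac{\max\{f(x)-f(y),0\}}{\|x-y\|}$; for lower semicontinuous convex $f$ it is characterized by $s_f(x)=\mathrm{dist}(0,\partial f(x))$, with the convention $\mathrm{dist}(0,\emptyset)=+\infty$ (in particular $s_f(x)=+\infty$ when $f(x)=+\infty$). Functions are not assumed bounded from below. *)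

theory Defs
  imports "HOL-Analysis.Analysis"
begin

text \<open>Functions into the reals extended by \<open>+\<infinity>\<close> are modelled as \<^typ>\<open>ereal\<close>-valued functions
  that never take the value \<open>-\<infinity>\<close>; this is part of properness.\<close>

definition proper_fun :: "('a \<Rightarrow> ereal) \<Rightarrow> bool" where
  "proper_fun f \<longleftrightarrow> (\<forall>x. f x \<noteq> -\<infinity>) \<and> (\<exists>x. f x \<noteq> \<infinity>)"

definition lsc_fun :: "('a::topological_space \<Rightarrow> ereal) \<Rightarrow> bool" where
  "lsc_fun f \<longleftrightarrow> (\<forall>x. f x \<le> Liminf (at x) f)"

definition convex_fun :: "('a::real_vector \<Rightarrow> ereal) \<Rightarrow> bool" where
  "convex_fun f \<longleftrightarrow> (\<forall>x y. \<forall>t::real. 0 < t \<and> t < 1 \<longrightarrow>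
     f ((1 - t) *\<^sub>R x + t *\<^sub>R y) \<le> ereal (1 - t) * f x + ereal t * f y)"

definition subdifferential :: "('a::real_inner \<Rightarrow> ereal) \<Rightarrow> 'a \<Rightarrow> 'a set" where
  "subdifferential f x =
     {v. f x \<noteq> \<infinity> \<and> (\<forall>y. f x + ereal (inner v (y - x)) \<le> f y)}"

definition subdifferential_range :: "('a::real_inner \<Rightarrow> ereal) \<Rightarrow> 'a set" where
  "subdifferential_range f = (\<Union>x. subdifferential f x)"

text \<open>The library's \<^const>\<open>closest_point\<close> is restricted to Heine-Borel (finite-dimensional)
  spaces. The description below is meaningful for nonempty closed convex sets in a Hilbert
  space.\<close>

definition metric_proj :: "'a::real_inner set \<Rightarrow> 'a \<Rightarrow> 'a" where
  "metric_proj C a = (THE p. p \<in> C \<and> (\<forall>q\<in>C. dist a p \<le> dist a q))"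

definition crandall_pazy :: "('a::real_inner \<Rightarrow> ereal) \<Rightarrow> 'a" where
  "crandall_pazy f = metric_proj (closure (subdifferential_range f)) 0"

text \<open>The outer maximum with \<open>0\<close> only matters in the zero space, where \<^term>\<open>at x\<close> is the
  trivial filter and the upper limit would be \<open>-\<infinity>\<close> instead of \<open>0\<close>; otherwise the quotients
  are nonnegative and it changes nothing.\<close>

definition slope :: "('a::real_normed_vector \<Rightarrow> ereal) \<Rightarrow> 'a \<Rightarrow> ereal" where
  "slope f x =
     (if f x = \<infinity> then \<infinity>
      else max 0 (Limsup (at x) (\<lambda>y. max (f x - f y) 0 / ereal (norm (x - y)))))"

end

theory Submission
  imports Defs
begin

text \<open>The proof compares \<open>f\<close> and \<open>g\<close> along a discrete steepest descent of \<open>f\<close>. Fix a step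
  size \<open>l > 0\<close> and a starting point with a subgradient \<open>v\<^sub>0\<close>, and iterate the resolvent:
  \<open>x\<^sub>n = x\<^sub>n\<^sub>+\<^sub>1 + l v\<^sub>n\<^sub>+\<^sub>1\<close> with \<open>v\<^sub>n\<^sub>+\<^sub>1 \<in> \<partial>f(x\<^sub>n\<^sub>+\<^sub>1)\<close>. One step lowers \<open>f\<close> by at least
  \<open>l |v\<^sub>n\<^sub>+\<^sub>1|\<^sup>2\<close>, whereas it lowers \<open>g\<close> by at most \<open>s\<^sub>g(x\<^sub>n) l |v\<^sub>n\<^sub>+\<^sub>1|\<close>, and
  \<open>s\<^sub>g(x\<^sub>n) = s\<^sub>f(x\<^sub>n) \<le> |v\<^sub>n|\<close>. As \<open>|v\<^sub>n|\<close> is nonincreasing, the losses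
  \<open>l |v\<^sub>n\<^sub>+\<^sub>1| (|v\<^sub>n| - |v\<^sub>n\<^sub>+\<^sub>1|)\<close> telescope, so that \<open>f - g\<close> at the start is at least its value at
  \<open>x\<^sub>n\<close> minus \<open>l |v\<^sub>0|\<^sup>2\<close> (\<open>difference_drop_along_iteration\<close>); this error vanishes with the step size.

  It remains to evaluate \<open>f - g\<close> far along the iteration. Let \<open>p\<close> be the common Crandall-Pazy
  direction and \<open>p \<in> \<partial>f(z)\<close>. Every subgradient \<open>u\<close> satisfies \<open>|p|\<^sup>2 \<le> \<langle>p, u\<rangle>\<close>
  (\<open>crandall_pazy_variational\<close>). Hence subgradients of norm close to \<open>|p|\<close> are close to \<open>p\<close>, and
  since \<open>s\<^sub>g(z) = s\<^sub>f(z) \<le> |p|\<close>, the vector \<open>p\<close> is a subgradient of both functions on the whole ray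
  \<open>z - t p\<close>, \<open>t \<ge> 0\<close> (\<open>crandall_pazy_along_ray\<close>); in particular \<open>f - g\<close> is constant there. The ray
  is itself a proximal iteration. Monotonicity of the subdifferential keeps \<open>x\<^sub>n\<close> at bounded distance
  from \<open>z\<^sub>n = z - n l p\<close> and forces \<open>v\<^sub>n \<rightarrow> p\<close> (\<open>distance_to_ray\<close>, \<open>v_tendsto\<close>). Then
  \<open>f(x\<^sub>n) \<ge> f(z\<^sub>n) + \<langle>p, x\<^sub>n - z\<^sub>n\<rangle>\<close>, while \<open>excess_le_slope_gap\<close> shows that \<open>g(x\<^sub>n)\<close> exceeds
  \<open>g(z\<^sub>n) + \<langle>p, x\<^sub>n - z\<^sub>n\<rangle>\<close> by at most \<open>sqrt (|v\<^sub>n|\<^sup>2 - |p|\<^sup>2) |x\<^sub>n - z\<^sub>n|\<close>, which tends to \<open>0\<close>.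
  Altogether \<open>f - g\<close> at the start is at least \<open>f(z) - g(z)\<close>. Approximation by resolvents and lower
  semicontinuity of \<open>g\<close> extend this to the whole effective domain of \<open>f\<close>, and exchanging \<open>f\<close>
  and \<open>g\<close> gives the equality.

  Existence of resolvents (\<open>resolvent_exists\<close>) is proved by minimising \<open>f + |\<sqdot> - x|\<^sup>2 / (2 l)\<close>, where
  strong convexity makes minimising sequences converge in norm.\<close>

section \<open>Preliminaries\<close>

text \<open>Inequalities between the values of \<open>f\<close> are stated for the real numbers \<open>rval f x\<close> at points
  of the effective domain, where they are those of \<open>f\<close>; outside it \<open>rval f x\<close> is the meaningless
  default \<open>0\<close>.\<close>

definition edom :: "('a \<Rightarrow> ereal) \<Rightarrow> 'a set" where
  "edom f = {x. f x \<noteq> \<infinity>}"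

definition rval :: "('a \<Rightarrow> ereal) \<Rightarrow> 'a \<Rightarrow> real" where
  "rval f x = real_of_ereal (f x)"

lemma Cauchy_if_norm_power2_le:
  fixes X :: "nat \<Rightarrow> 'a::real_inner"
  assumes le: "\<And>m n. m \<le> n \<Longrightarrow> (norm (X m - X n))\<^sup>2 \<le> a m" and lim: "a \<longlonglongrightarrow> 0"
  shows "Cauchy X"
proof (rule CauchyI')
  fix e :: real assume e: "e > 0"
  have "\<forall>\<^sub>F m in sequentially. a m < e\<^sup>2"
    using order_tendstoD(2)[OF lim, of "e\<^sup>2"] e by simp
  then obtain M where M: "\<And>m. m \<ge> M \<Longrightarrow> a m < e\<^sup>2"
    by (auto simp: eventually_sequentially)
  have "dist (X m) (X n) < e" if "m \<ge> M" "n > m" for m n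
  proof -
    have "(norm (X m - X n))\<^sup>2 < e\<^sup>2" using le[of m n] M[of m] that by simp
    then show ?thesis using e by (simp add: dist_norm power2_less_imp_less)
  qed
  then show "\<exists>M. \<forall>m\<ge>M. \<forall>n>m. dist (X m) (X n) < e" by blast
qed

lemma norm_add_scaleR_power2:
  fixes u w :: "'a::real_inner"
  shows "(norm (u + t *\<^sub>R w))\<^sup>2 = (norm u)\<^sup>2 + 2 * t * (u \<bullet> w) + t\<^sup>2 * (norm w)\<^sup>2"
  unfolding power2_norm_eq_inner inner_add_left inner_add_right inner_scaleR_left inner_scaleR_right
  by (simp add: inner_commute[of w u] power2_eq_square distrib_left)

text \<open>The variational inequality of a metric projection of \<open>0\<close> turns closeness of norms into
  closeness of vectors.\<close>
lemma norm_diff_power2_le: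
  fixes p v :: "'a::real_inner"
  assumes "(norm p)\<^sup>2 \<le> p \<bullet> v"
  shows "(norm (v - p))\<^sup>2 \<le> (norm v)\<^sup>2 - (norm p)\<^sup>2"
  using assms by (simp add: power2_norm_eq_inner inner_diff_left inner_diff_right inner_commute)

lemma tendsto_if_norm_power2_le:
  fixes X :: "nat \<Rightarrow> 'a::real_normed_vector"
  assumes le: "\<And>n. (norm (X n - L))\<^sup>2 \<le> a n" and lim: "a \<longlonglongrightarrow> 0"
  shows "X \<longlonglongrightarrow> L"
proof (rule LIM_zero_cancel, rule Lim_null_comparison)
  show "\<forall>\<^sub>F n in sequentially. norm (X n - L) \<le> sqrt (a n)"
    using le by (intro always_eventually allI real_le_rsqrt)
  show "(\<lambda>n. sqrt (a n)) \<longlonglongrightarrow> 0"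
    using tendsto_real_sqrt[OF lim] by simp
qed

lemma decseq_increments_tendsto_0:
  fixes a :: "nat \<Rightarrow> real"
  assumes "\<And>n. a (Suc n) \<le> a n" and "\<And>n. 0 \<le> a n"
  shows "(\<lambda>n. a n - a (Suc n)) \<longlonglongrightarrow> 0"
proof -
  have "decseq a" using assms(1) by (rule decseq_SucI)
  then obtain L where L: "a \<longlonglongrightarrow> L" using decseq_convergent assms(2) by metis
  show ?thesis using tendsto_diff[OF L LIMSEQ_Suc[OF L]] by simp
qed

section \<open>Convex lower semicontinuous functions and their subgradients\<close>

locale proper_lsc_convex =
  fixes f :: "'a::{real_inner, complete_space} \<Rightarrow> ereal"
  assumes proper: "proper_fun f" and lsc: "lsc_fun f" and convex: "convex_fun f"
begin

lemma edom_nonempty: "edom f \<noteq> {}"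
  using proper by (auto simp: proper_fun_def edom_def)

lemma ereal_rval: "x \<in> edom f \<Longrightarrow> f x = ereal (rval f x)"
  using proper by (cases "f x") (auto simp: proper_fun_def edom_def rval_def)

lemma edom_rvalI: "f x \<le> ereal a \<Longrightarrow> x \<in> edom f \<and> rval f x \<le> a"
  using proper by (cases "f x") (auto simp: proper_fun_def edom_def rval_def)

lemma convex_rval:
  assumes x: "x \<in> edom f" and y: "y \<in> edom f" and t: "0 < t" "t < 1"
  shows "x + t *\<^sub>R (y - x) \<in> edom f"
    and "rval f (x + t *\<^sub>R (y - x)) \<le> (1 - t) * rval f x + t * rval f y"
proof -
  have eq: "x + t *\<^sub>R (y - x) = (1 - t) *\<^sub>R x + t *\<^sub>R y" by (simp add: algebra_simps)
  have "f (x + t *\<^sub>R (y - x)) \<le> ereal (1 - t) * f x + ereal t * f y"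
    using convex t unfolding convex_fun_def eq by blast
  then have "f (x + t *\<^sub>R (y - x)) \<le> ereal ((1 - t) * rval f x + t * rval f y)"
    by (simp add: ereal_rval[OF x] ereal_rval[OF y])
  from edom_rvalI[OF this] show "x + t *\<^sub>R (y - x) \<in> edom f"
    and "rval f (x + t *\<^sub>R (y - x)) \<le> (1 - t) * rval f x + t * rval f y" by auto
qed

lemma eventually_nhds_gt:
  assumes "c < f x"
  shows "\<forall>\<^sub>F y in nhds x. c < f y"
proof -
  have "f x \<le> Liminf (at x) f" using lsc by (simp add: lsc_fun_def)
  then have "\<forall>\<^sub>F y in at x. c < f y" using assms by (auto simp: le_Liminf_iff)
  then show ?thesis using assms by (simp add: eventually_nhds_conv_at)
qed

lemma lsc_sequential:
  assumes X: "X \<longlonglongrightarrow> x" and dom: "\<And>n. X n \<in> edom f"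
    and le: "\<And>n. rval f (X n) \<le> a n" and a: "a \<longlonglongrightarrow> A"
  shows "x \<in> edom f" and "rval f x \<le> A"
proof -
  have "f x \<le> ereal A"
  proof (rule ccontr)
    assume "\<not> f x \<le> ereal A"
    then have "ereal A < f x" by simp
    then obtain c where c: "ereal A < ereal c" "ereal c < f x"
      using ereal_dense2 by blast
    have "\<forall>\<^sub>F n in sequentially. ereal c < f (X n)"
      using eventually_nhds_gt[OF c(2)] X unfolding filterlim_iff by blast
    moreover have "\<forall>\<^sub>F n in sequentially. a n < c"
      using order_tendstoD(2)[OF a] c(1) by simp
    ultimately have "\<forall>\<^sub>F n in sequentially. False"
    proof eventually_elim
      case (elim n)
      then show False using le[of n] ereal_rval[OF dom[of n]] by simp
    qed
    then show False by simp
  qed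
  from edom_rvalI[OF this] show "x \<in> edom f" "rval f x \<le> A" by auto
qed

lemma subdifferential_iff:
  "v \<in> subdifferential f x \<longleftrightarrow>
     x \<in> edom f \<and> (\<forall>y\<in>edom f. rval f x + v \<bullet> (y - x) \<le> rval f y)"
proof -
  have "(f x + ereal (v \<bullet> (y - x)) \<le> f y) \<longleftrightarrow>
      (y \<in> edom f \<longrightarrow> rval f x + v \<bullet> (y - x) \<le> rval f y)" if "x \<in> edom f" for y
  proof (cases "y \<in> edom f")
    case True then show ?thesis by (simp add: ereal_rval[OF that] ereal_rval[OF True])
  next
    case False then show ?thesis by (simp add: edom_def)
  qed
  then show ?thesis by (auto simp: subdifferential_def edom_def)
qed

lemma subdifferentialD:
  assumes "v \<in> subdifferential f x"
  shows "x \<in> edom f" and "y \<in> edom f \<Longrightarrow> rval f x + v \<bullet> (y - x) \<le> rval f y"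
  using assms by (auto simp: subdifferential_iff)

lemma subdifferential_monotone:
  assumes "v \<in> subdifferential f x" and "w \<in> subdifferential f y"
  shows "0 \<le> (v - w) \<bullet> (x - y)"
proof -
  have "rval f x + v \<bullet> (y - x) \<le> rval f y" "rval f y + w \<bullet> (x - y) \<le> rval f x"
    using assms by (auto simp: subdifferential_iff)
  then show ?thesis by (simp add: algebra_simps)
qed

text \<open>Lower semicontinuity bounds \<open>f\<close> below on a small ball around a point \<open>z\<close> of the effective
  domain. A point outside the ball is joined to \<open>z\<close> by a segment whose convexity inequality at a point
  inside the ball leaves room only for a linear decrease.\<close>
lemma linear_minorant:
  "\<exists>a b. b \<ge> 0 \<and> (\<forall>y\<in>edom f. a - b * norm (y - x) \<le> rval f y)"
proof -
  obtain z where z: "z \<in> edom f" using edom_nonempty by auto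
  have "ereal (rval f z - 1) < f z" using ereal_rval[OF z] by simp
  from eventually_nhds_gt[OF this] obtain d where d: "d > 0"
    and near: "\<And>y. dist y z < d \<Longrightarrow> ereal (rval f z - 1) < f y"
    by (auto simp: eventually_nhds_metric)
  have near': "rval f z - 1 < rval f y" if "y \<in> edom f" "dist y z < d" for y
    using near[OF that(2)] ereal_rval[OF that(1)] by simp
  have bd: "rval f z - 1 - 2 / d * norm (y - z) \<le> rval f y" if y: "y \<in> edom f" for y
  proof (cases "dist y z < d")
    case True
    then show ?thesis using near'[OF y True] d
      by (smt (verit) divide_nonneg_pos mult_nonneg_nonneg norm_ge_zero)
  next
    case False
    define r where "r = norm (y - z)"
    \<comment> \<open>The factor moves \<open>y\<close> along the segment to distance \<open>d / 2\<close> from \<open>z\<close>, safely inside the ball.\<close>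
    define t where "t = d / (2 * r)"
    have r: "r \<ge> d" using False by (simp add: r_def dist_norm)
    then have t: "0 < t" "t < 1" using d by (auto simp: t_def field_simps)
    have "dist (z + t *\<^sub>R (y - z)) z = t * r" using t by (simp add: dist_norm r_def)
    also have "\<dots> < d" using d r by (simp add: t_def)
    finally have "rval f z - 1 < rval f (z + t *\<^sub>R (y - z))"
      using near' convex_rval(1)[OF z y t] by simp
    also have "\<dots> \<le> (1 - t) * rval f z + t * rval f y"
      using convex_rval(2)[OF z y t] .
    finally have "t * (rval f z - rval f y) < 1" by (simp add: algebra_simps)
    then have "rval f z - rval f y < 1 / t" using t by (simp add: field_simps)
    also have "1 / t = 2 / d * r" using d by (simp add: t_def)
    finally show ?thesis by (simp add: r_def)
  qed
  have "rval f z - 1 - 2 / d * norm (x - z) - 2 / d * norm (y - x) \<le> rval f y"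
    if y: "y \<in> edom f" for y
  proof -
    have "norm (y - z) \<le> norm (y - x) + norm (x - z)"
      using norm_triangle_ineq[of "y - x" "x - z"] by simp
    then have "2 / d * norm (y - z) \<le> 2 / d * (norm (y - x) + norm (x - z))"
      using d by (intro mult_left_mono) auto
    then show ?thesis using bd[OF y] by (simp add: algebra_simps)
  qed
  then show ?thesis using d
    by (intro exI[of _ "rval f z - 1 - 2 / d * norm (x - z)"] exI[of _ "2 / d"]) auto
qed

section \<open>Resolvents\<close>

text \<open>Minty's theorem for the subdifferential. The function \<open>h = f + |\<sqdot> - x|\<^sup>2 / (2 l)\<close> is bounded
  below because the quadratic term dominates the linear minorant. The parallelogram identity makes every
  minimising sequence of \<open>h\<close> Cauchy, lower semicontinuity makes its limit \<open>y\<close> a minimiser, and the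
  first-order condition at \<open>y\<close> says that \<open>(x - y) / l\<close> is a subgradient.\<close>
lemma resolvent_exists:
  assumes l: "0 < l"
  obtains y v where "v \<in> subdifferential f y" and "x = y + l *\<^sub>R v"
proof -
  define h where "h y = rval f y + (norm (y - x))\<^sup>2 / (2 * l)" for y
  obtain a b where b: "b \<ge> 0" and ab: "\<And>y. y \<in> edom f \<Longrightarrow> a - b * norm (y - x) \<le> rval f y"
    using linear_minorant[of x] by auto
  have below: "a - l * b\<^sup>2 / 2 \<le> h y" if "y \<in> edom f" for y
  proof -
    have "0 \<le> (norm (y - x) - l * b)\<^sup>2 / (2 * l)" using l by simp
    also have "\<dots> = (norm (y - x))\<^sup>2 / (2 * l) - b * norm (y - x) + l * b\<^sup>2 / 2"
      using l by (simp add: power2_eq_square field_simps)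
    finally show ?thesis using ab[OF that] by (simp add: h_def)
  qed
  have bdd: "bdd_below (h ` edom f)" using below by (auto intro!: bdd_belowI)
  define m where "m = Inf (h ` edom f)"
  have m_le: "m \<le> h y" if "y \<in> edom f" for y
    unfolding m_def using bdd that by (auto intro: cInf_lower)
  define d where "d n = inverse (real (Suc n))" for n
  have d0: "d \<longlonglongrightarrow> 0" unfolding d_def by (rule LIMSEQ_inverse_real_of_nat)
  have "\<exists>y\<in>edom f. h y < m + d n" for n
    using cInf_lessD[of "h ` edom f" "m + d n"] edom_nonempty
    by (auto simp: m_def d_def)
  then obtain X where X: "\<And>n. X n \<in> edom f"
    and hX: "\<And>n. h (X n) < m + d n"
    by metis
  have mid: "(norm (y - z))\<^sup>2 \<le> 8 * l * ((h y + h z) / 2 - m)"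
    if y: "y \<in> edom f" and z: "z \<in> edom f" for y z
  proof -
    define w where "w = y + (1/2) *\<^sub>R (z - y)"
    have w: "w \<in> edom f" "rval f w \<le> (rval f y + rval f z) / 2"
      using convex_rval[OF y z, of "1/2"] by (auto simp: w_def algebra_simps)
    have "w - x = (1/2) *\<^sub>R ((y - x) + (z - x))"
      by (simp add: w_def algebra_simps flip: scaleR_left.add)
    then have "(norm (w - x))\<^sup>2 = (norm ((y - x) + (z - x)))\<^sup>2 / 4"
      by (simp add: power_divide)
    also have "\<dots> = ((norm (y - x))\<^sup>2 + (norm (z - x))\<^sup>2) / 2 - (norm (y - z))\<^sup>2 / 4"
      using norm_add_scaleR_power2[of "y - x" 1 "z - x"] norm_add_scaleR_power2[of "y - x" "-1" "z - x"]
      by (simp add: field_simps)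
    finally have nw: "(norm (w - x))\<^sup>2 =
      ((norm (y - x))\<^sup>2 + (norm (z - x))\<^sup>2) / 2 - (norm (y - z))\<^sup>2 / 4" .
    have "(norm (w - x))\<^sup>2 / (2 * l) =
        ((norm (y - x))\<^sup>2 / (2 * l) + (norm (z - x))\<^sup>2 / (2 * l)) / 2 - (norm (y - z))\<^sup>2 / (8 * l)"
      unfolding nw by (simp add: diff_divide_distrib add_divide_distrib)
    then have "h w \<le> (h y + h z) / 2 - (norm (y - z))\<^sup>2 / (8 * l)"
      using w(2) unfolding h_def by argo
    then have "(norm (y - z))\<^sup>2 / (8 * l) \<le> (h y + h z) / 2 - m"
      using m_le[OF w(1)] by simp
    then show ?thesis using l by (simp add: pos_divide_le_eq mult.commute)
  qed
  have "Cauchy X"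
  proof (rule Cauchy_if_norm_power2_le)
    fix i j :: nat assume "i \<le> j"
    then have "d j \<le> d i" by (simp add: d_def)
    then have "(h (X i) + h (X j)) / 2 - m \<le> d i"
      using hX[of i] hX[of j] by argo
    then have "8 * l * ((h (X i) + h (X j)) / 2 - m) \<le> 8 * l * d i"
      using l by (intro mult_left_mono) auto
    then show "(norm (X i - X j))\<^sup>2 \<le> 8 * l * d i"
      using mid[OF X X, of i j] by linarith
  next
    show "(\<lambda>i. 8 * l * d i) \<longlonglongrightarrow> 0"
      using tendsto_mult_right_zero[OF d0] by blast
  qed
  then obtain y where y: "X \<longlonglongrightarrow> y" using Cauchy_convergent convergent_def by blast
  have bound: "rval f (X n) \<le> m + d n - (norm (X n - x))\<^sup>2 / (2 * l)" for n
    using hX[of n] by (simp add: h_def)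
  have bound_lim: "(\<lambda>n. m + d n - (norm (X n - x))\<^sup>2 / (2 * l))
      \<longlonglongrightarrow> m + 0 - (norm (y - x))\<^sup>2 / (2 * l)"
    using l by (intro tendsto_intros y d0) auto
  have yD: "y \<in> edom f" and "rval f y \<le> m - (norm (y - x))\<^sup>2 / (2 * l)"
    using lsc_sequential[OF y X bound bound_lim] by simp_all
  then have hy: "h y \<le> m" by (simp add: h_def)
  \<comment> \<open>Comparing \<open>h y\<close> with \<open>h\<close> at \<open>y + t (z - y)\<close> gives the subgradient inequality up to an error of order \<open>t\<close>.\<close>
  define v where "v = (1 / l) *\<^sub>R (x - y)"
  have "rval f y + v \<bullet> (z - y) \<le> rval f z" if z: "z \<in> edom f" for z
  proof -
    have step: "rval f y + v \<bullet> (z - y) - rval f z \<le> t * ((norm (z - y))\<^sup>2 / (2 * l))"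
      if t: "0 < t" "t < 1" for t
    proof -
      define w where "w = y + t *\<^sub>R (z - y)"
      have "w \<in> edom f" and le: "rval f w \<le> (1 - t) * rval f y + t * rval f z"
        using convex_rval[OF yD z t] by (auto simp: w_def)
      then have "h y \<le> h w" using hy m_le[of w] by linarith
      have "(norm (w - x))\<^sup>2 = (norm ((y - x) + t *\<^sub>R (z - y)))\<^sup>2"
        by (simp add: w_def algebra_simps)
      also have "\<dots> = (norm (y - x))\<^sup>2 + 2 * t * ((y - x) \<bullet> (z - y)) + t\<^sup>2 * (norm (z - y))\<^sup>2"
        by (simp add: norm_add_scaleR_power2)
      also have "(y - x) \<bullet> (z - y) = - l * (v \<bullet> (z - y))"
        using l by (simp add: v_def inner_diff_left)
      finally have "h w = rval f w + (norm (y - x))\<^sup>2 / (2 * l)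
          - t * (v \<bullet> (z - y)) + t\<^sup>2 * ((norm (z - y))\<^sup>2 / (2 * l))"
        using l by (simp add: h_def add_divide_distrib diff_divide_distrib)
      with \<open>h y \<le> h w\<close> le have
        "t * (rval f y + v \<bullet> (z - y) - rval f z) \<le> t * (t * ((norm (z - y))\<^sup>2 / (2 * l)))"
        by (simp add: h_def algebra_simps power2_eq_square)
      then show ?thesis using t(1) mult_le_cancel_left_pos by blast
    qed
    have "rval f y + v \<bullet> (z - y) - rval f z \<le> 0"
    proof (rule tendsto_lowerbound)
      show "((\<lambda>t. t * ((norm (z - y))\<^sup>2 / (2 * l))) \<longlongrightarrow> 0) (at_right 0)"
        by (intro tendsto_mult_left_zero tendsto_ident_at)
      show "\<forall>\<^sub>F t in at_right 0. rval f y + v \<bullet> (z - y) - rval f z \<le> t * ((norm (z - y))\<^sup>2 / (2 * l))"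
        unfolding eventually_at_right_field using step by (intro exI[of _ 1]) simp
    qed simp
    then show ?thesis by simp
  qed
  then have "v \<in> subdifferential f y" using yD by (simp add: subdifferential_iff)
  moreover have "x = y + l *\<^sub>R v" using l by (simp add: v_def)
  ultimately show thesis using that by blast
qed


section \<open>Slope and subgradients\<close>

lemma slope_nonneg: "0 \<le> slope f x"
  by (simp add: slope_def)

lemma slope_finite_edom: "slope f x \<le> ereal s \<Longrightarrow> x \<in> edom f"
  by (auto simp: slope_def edom_def)

lemma slope_quotient:
  assumes "x \<in> edom f" and "y \<in> edom f" and "y \<noteq> x"
  shows "max (f x - f y) 0 / ereal (norm (x - y)) =
    ereal (max (rval f x - rval f y) 0 / norm (x - y))"
  using assms by (auto simp: ereal_rval max_def)

lemma slope_le_norm_subgradient: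
  assumes v: "v \<in> subdifferential f x"
  shows "slope f x \<le> ereal (norm v)"
proof -
  have x: "x \<in> edom f" using subdifferentialD(1)[OF v] .
  have "max (f x - f y) 0 / ereal (norm (x - y)) \<le> ereal (norm v)" if "y \<noteq> x" for y
  proof (cases "y \<in> edom f")
    case True
    have "rval f x - rval f y \<le> v \<bullet> (x - y)"
      using subdifferentialD(2)[OF v True] by (simp add: inner_diff_right)
    also have "\<dots> \<le> norm v * norm (x - y)" by (rule norm_cauchy_schwarz)
    finally have "max (rval f x - rval f y) 0 / norm (x - y) \<le> norm v"
      using that by (simp add: pos_divide_le_eq)
    then show ?thesis using slope_quotient[OF x True that] by simp
  next
    case False
    then show ?thesis using ereal_rval[OF x] by (simp add: edom_def)
  qed
  then have "\<forall>\<^sub>F y in at x. max (f x - f y) 0 / ereal (norm (x - y)) \<le> ereal (norm v)"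
    by (auto simp: eventually_at_filter)
  then have "Limsup (at x) (\<lambda>y. max (f x - f y) 0 / ereal (norm (x - y))) \<le> ereal (norm v)"
    by (rule Limsup_bounded)
  then show ?thesis using x by (simp add: slope_def edom_def)
qed

text \<open>By convexity the difference quotient of \<open>f\<close> along a segment does not decrease as the end point
  approaches \<open>x\<close>; hence the slope, a purely local quantity, controls every descent.\<close>
lemma diff_le_slope:
  assumes s: "slope f x \<le> ereal s" and y: "y \<in> edom f"
  shows "rval f x - rval f y \<le> s * norm (x - y)"
proof (cases "y = x")
  case False
  have x: "x \<in> edom f" using slope_finite_edom[OF s] .
  define r where "r = norm (x - y)"
  have r: "r > 0" using False by (simp add: r_def)
  show ?thesis
  proof (rule ccontr)
    assume "\<not> ?thesis"
    then have "s < (rval f x - rval f y) / r" using r by (simp add: r_def pos_less_divide_eq)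
    moreover have "0 \<le> s" using order_trans[OF slope_nonneg s] by simp
    moreover have "Limsup (at x) (\<lambda>y. max (f x - f y) 0 / ereal (norm (x - y))) \<le> ereal s"
      using s x by (simp add: slope_def edom_def)
    ultimately have "Limsup (at x) (\<lambda>y. max (f x - f y) 0 / ereal (norm (x - y)))
        < ereal ((rval f x - rval f y) / r)"
      using le_less_trans by fastforce
    from Limsup_lessD[OF this] obtain d where d: "d > 0" and near:
      "\<And>z. z \<noteq> x \<Longrightarrow> dist z x < d \<Longrightarrow>
        max (f x - f z) 0 / ereal (norm (x - z)) < ereal ((rval f x - rval f y) / r)"
      by (auto simp: eventually_at)
    \<comment> \<open>A factor small enough to land in the neighbourhood, and below \<open>1\<close> to stay inside the segment.\<close>
    define t where "t = min (1/2) (d / (2 * r))"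
    have t: "0 < t" "t < 1" using d r by (auto simp: t_def)
    define z where "z = x + t *\<^sub>R (y - x)"
    have z: "z \<in> edom f" and le: "rval f z \<le> (1 - t) * rval f x + t * rval f y"
      using convex_rval[OF x y t] by (auto simp: z_def)
    have dist: "norm (x - z) = t * r" using t by (simp add: z_def r_def norm_minus_commute)
    have "t * r \<le> d / (2 * r) * r" using r by (intro mult_right_mono) (auto simp: t_def)
    also have "\<dots> < d" using d r by simp
    finally have "dist z x < d" using dist by (simp add: dist_norm norm_minus_commute)
    moreover have "z \<noteq> x" using dist t r by auto
    ultimately have "max (rval f x - rval f z) 0 / (t * r) < (rval f x - rval f y) / r"
      using near[of z] slope_quotient[OF x z] dist by simp
    then have "max (rval f x - rval f z) 0 < t * (rval f x - rval f y)"
      using t r by (simp add: pos_divide_less_eq mult.commute)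
    then show False using le by (simp add: algebra_simps)
  qed
qed simp

text \<open>The resolvent step is a descent of at least \<open>l |v|\<^sup>2\<close> over a distance \<open>l |v|\<close>, so the slope
  bounds \<open>|v|\<close>. With \<open>l \<rightarrow> 0\<close> this yields subgradients of norm at most the slope at points
  arbitrarily close to \<open>x\<close>.\<close>
lemma bounded_subgradient_nearby:
  assumes s: "slope f x \<le> ereal s" and l: "0 < l"
  obtains y v where "v \<in> subdifferential f y" and "x = y + l *\<^sub>R v" and "norm v \<le> s"
proof -
  obtain y v where v: "v \<in> subdifferential f y" and x: "x = y + l *\<^sub>R v"
    using resolvent_exists[OF l] .
  have "l * (norm v)\<^sup>2 = v \<bullet> (x - y)" by (simp add: x power2_norm_eq_inner)
  also have "\<dots> \<le> rval f x - rval f y"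
    using subdifferentialD(2)[OF v slope_finite_edom[OF s]] by simp
  also have "\<dots> \<le> s * norm (x - y)"
    using diff_le_slope[OF s subdifferentialD(1)[OF v]] .
  also have "\<dots> = l * (s * norm v)" using l by (simp add: x)
  finally have "norm v * norm v \<le> s * norm v" using l by (simp add: power2_eq_square)
  moreover have "0 \<le> s" using order_trans[OF slope_nonneg s] by simp
  ultimately have "norm v \<le> s" by (cases "v = 0") auto
  with v x show thesis using that by blast
qed

section \<open>The Crandall-Pazy direction\<close>

text \<open>A vector with this variational inequality is the projection of \<open>0\<close>. It is obtained as the
  limit of \<open>v\<^sub>n = - y\<^sub>n / (n + 1)\<close>, where
  \<open>y\<^sub>n\<close> is the resolvent of the origin with parameter \<open>n + 1\<close>: monotonicity gives
  \<open>|v\<^sub>m - v\<^sub>n|\<^sup>2 \<le> |v\<^sub>m|\<^sup>2 - |v\<^sub>n|\<^sup>2\<close> for \<open>m \<le> n\<close>, so the sequence is Cauchy; and the monotonicity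
  inequality against a fixed subgradient, divided by \<open>n + 1\<close>, becomes the variational inequality.\<close>
lemma minimal_recession_vector:
  "\<exists>q\<in>closure (subdifferential_range f). \<forall>u\<in>subdifferential_range f. (norm q)\<^sup>2 \<le> q \<bullet> u"
proof -
  have "\<exists>v. v \<in> subdifferential f (- (real (Suc n) *\<^sub>R v))" for n
  proof -
    have "0 < real (Suc n)" by simp
    from resolvent_exists[OF this, where x = 0] obtain y v where
      "v \<in> subdifferential f y" "0 = y + real (Suc n) *\<^sub>R v" .
    moreover from this have "y = - (real (Suc n) *\<^sub>R v)" by (simp only: eq_neg_iff_add_eq_0)
    ultimately show ?thesis by blast
  qed
  then obtain V where V': "\<And>n. V n \<in> subdifferential f (- (real (Suc n) *\<^sub>R V n))" by metis
  define Y where "Y n = - (real (Suc n) *\<^sub>R V n)" for n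
  have V: "V n \<in> subdifferential f (Y n)" for n using V' unfolding Y_def .
  have drop: "(norm (V m - V n))\<^sup>2 \<le> (norm (V m))\<^sup>2 - (norm (V n))\<^sup>2" if "m \<le> n" for m n
  proof (cases "m = n")
    case False
    define l k where "l = real (Suc m)" and "k = real n - real m"
    have l: "l > 0" and k: "k > 0" using that False by (auto simp: l_def k_def)
    have "Y m - Y n = k *\<^sub>R V n - l *\<^sub>R (V m - V n)"
      by (simp add: Y_def l_def k_def algebra_simps)
    then have "0 \<le> k * ((V m - V n) \<bullet> V n) - l * (norm (V m - V n))\<^sup>2"
      using subdifferential_monotone[OF V[of m] V[of n]]
      by (simp add: inner_diff_right power2_norm_eq_inner)
    moreover have "0 \<le> l * (norm (V m - V n))\<^sup>2" using l by simp
    ultimately have "0 \<le> k * ((V m - V n) \<bullet> V n)" by linarith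
    then have "0 \<le> (V m - V n) \<bullet> V n" using k by (simp add: zero_le_mult_iff)
    then show ?thesis
      by (simp add: power2_norm_eq_inner inner_diff_left inner_diff_right inner_commute)
  qed simp
  have "decseq (\<lambda>n. (norm (V n))\<^sup>2)"
  proof (rule decseq_SucI)
    show "(norm (V (Suc n)))\<^sup>2 \<le> (norm (V n))\<^sup>2" for n
      using drop[of n "Suc n"] zero_le_power2[of "norm (V n - V (Suc n))"] by linarith
  qed
  then obtain L where L: "(\<lambda>n. (norm (V n))\<^sup>2) \<longlonglongrightarrow> L" and L_le: "\<And>n. L \<le> (norm (V n))\<^sup>2"
    using decseq_convergent[of "\<lambda>n. (norm (V n))\<^sup>2" 0] by auto
  have "Cauchy V"
  proof (rule Cauchy_if_norm_power2_le)
    show "(norm (V m - V n))\<^sup>2 \<le> (norm (V m))\<^sup>2 - L" if "m \<le> n" for m n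
      using drop[OF that] L_le[of n] by simp
    show "(\<lambda>m. (norm (V m))\<^sup>2 - L) \<longlonglongrightarrow> 0"
      using tendsto_diff[OF L tendsto_const[of L]] by simp
  qed
  then obtain q where q: "V \<longlonglongrightarrow> q" using Cauchy_convergent convergent_def by blast
  show ?thesis
  proof (intro bexI ballI)
    show "q \<in> closure (subdifferential_range f)"
      unfolding closure_sequential using V q
      by (intro exI[of _ V]) (auto simp: subdifferential_range_def)
    fix u assume "u \<in> subdifferential_range f"
    then obtain x where u: "u \<in> subdifferential f x" by (auto simp: subdifferential_range_def)
    have "(V n - u) \<bullet> V n \<le> - ((V n - u) \<bullet> x) * inverse (real (Suc n))" for n
    proof -
      have "0 \<le> (V n - u) \<bullet> (- (real (Suc n) *\<^sub>R V n) - x)"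
        using subdifferential_monotone[OF V u, of n] unfolding Y_def .
      then have "real (Suc n) * ((V n - u) \<bullet> V n) \<le> - ((V n - u) \<bullet> x)"
        by (simp add: inner_diff_right)
      then show ?thesis by (simp add: field_simps del: of_nat_Suc)
    qed
    moreover have "(\<lambda>n. - ((V n - u) \<bullet> x) * inverse (real (Suc n))) \<longlonglongrightarrow> - ((q - u) \<bullet> x) * 0"
      by (intro tendsto_intros q LIMSEQ_inverse_real_of_nat)
    moreover have "(\<lambda>n. (V n - u) \<bullet> V n) \<longlonglongrightarrow> (q - u) \<bullet> q"
      by (intro tendsto_intros q)
    ultimately have "(q - u) \<bullet> q \<le> - ((q - u) \<bullet> x) * 0"
      using LIMSEQ_le by blast
    then show "(norm q)\<^sup>2 \<le> q \<bullet> u"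
      by (simp add: power2_norm_eq_inner inner_commute[of "q - u"] inner_diff_right)
  qed
qed

text \<open>The definition of the direction is a definite description. The vector found above
  satisfies it, and its variational inequality, which extends to the closure, excludes any other
  vector of minimal norm.\<close>
lemma crandall_pazy_variational:
  assumes u: "u \<in> subdifferential_range f"
  shows "(norm (crandall_pazy f))\<^sup>2 \<le> crandall_pazy f \<bullet> u"
proof -
  obtain q where q: "q \<in> closure (subdifferential_range f)"
    and le: "\<And>u. u \<in> subdifferential_range f \<Longrightarrow> (norm q)\<^sup>2 \<le> q \<bullet> u"
    using minimal_recession_vector by blast
  have le': "(norm q)\<^sup>2 \<le> q \<bullet> w" if "w \<in> closure (subdifferential_range f)" for w
  proof -
    have "closure (subdifferential_range f) \<subseteq> {w. (norm q)\<^sup>2 \<le> q \<bullet> w}"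
      using le by (intro closure_minimal closed_halfspace_ge) (auto simp: inner_commute)
    then show ?thesis using that by auto
  qed
  have "crandall_pazy f = q"
    unfolding crandall_pazy_def metric_proj_def
  proof (rule the_equality, intro conjI ballI)
    fix w assume w: "w \<in> closure (subdifferential_range f)"
    have "norm q * norm q \<le> norm q * norm w"
      using le'[OF w] norm_cauchy_schwarz[of q w] by (simp add: power2_eq_square)
    then show "dist 0 q \<le> dist 0 w" by (cases "q = 0") auto
  next
    fix p assume p: "p \<in> closure (subdifferential_range f) \<and>
      (\<forall>w\<in>closure (subdifferential_range f). dist 0 p \<le> dist 0 w)"
    then have "norm p \<le> norm q" using q by simp
    then have "(norm p)\<^sup>2 \<le> (norm q)\<^sup>2" by (simp add: power_mono)
    then have "(norm (p - q))\<^sup>2 \<le> 0" using norm_diff_power2_le[OF le', of p] p by linarith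
    then show "p = q" by simp
  qed (rule q)
  then show ?thesis using le[OF u] by simp
qed

text \<open>The nearby subgradient at distance \<open>t |v|\<close> from \<open>x\<close> has norm at most that of the Crandall-Pazy
  direction, so it is that direction, and its base point is then forced to lie on the ray. The case
  \<open>t = 0\<close> follows by lower semicontinuity.\<close>
lemma crandall_pazy_along_ray:
  assumes x: "slope f x \<le> ereal (norm (crandall_pazy f))" and t: "0 \<le> t"
  shows "crandall_pazy f \<in> subdifferential f (x - t *\<^sub>R crandall_pazy f)"
proof -
  let ?p = "crandall_pazy f"
  have pos: "?p \<in> subdifferential f (x - t *\<^sub>R ?p)" if t: "0 < t" for t
  proof -
    obtain y v where v: "v \<in> subdifferential f y" and y: "x = y + t *\<^sub>R v" and "norm v \<le> norm ?p"
      using bounded_subgradient_nearby[OF x t] .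
    then have "(norm v)\<^sup>2 \<le> (norm ?p)\<^sup>2" by (simp add: power_mono)
    moreover have "v \<in> subdifferential_range f" using v by (auto simp: subdifferential_range_def)
    ultimately have "(norm (v - ?p))\<^sup>2 \<le> 0"
      using norm_diff_power2_le[OF crandall_pazy_variational, of v] by linarith
    then have "v = ?p" by simp
    then show ?thesis using v y by simp
  qed
  show ?thesis
  proof (cases "t = 0")
    case True
    define X where "X n = x - inverse (real (Suc n)) *\<^sub>R ?p" for n
    have X: "X \<longlonglongrightarrow> x - 0 *\<^sub>R ?p"
      unfolding X_def by (intro tendsto_intros LIMSEQ_inverse_real_of_nat)
    have sub: "?p \<in> subdifferential f (X n)" for n
      unfolding X_def by (rule pos) simp
    have "x \<in> edom f" using slope_finite_edom[OF x] .
    moreover have "rval f x + ?p \<bullet> (y - x) \<le> rval f y" if y: "y \<in> edom f" for y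
    proof -
      have le: "rval f (X n) \<le> rval f y - ?p \<bullet> (y - X n)" for n
        using subdifferentialD(2)[OF sub y, of n] by simp
      have "(\<lambda>n. rval f y - ?p \<bullet> (y - X n)) \<longlonglongrightarrow> rval f y - ?p \<bullet> (y - (x - 0 *\<^sub>R ?p))"
        by (intro tendsto_intros X)
      from lsc_sequential(2)[OF X subdifferentialD(1)[OF sub] le this] show ?thesis by simp
    qed
    ultimately show ?thesis using True by (simp add: subdifferential_iff)
  qed (use pos t in simp)
qed

text \<open>How far \<open>f\<close> can exceed the affine minorant given by \<open>p\<close> at \<open>z\<close>. At points close to \<open>x\<close> there are
  subgradients of norm at most \<open>s\<close>; by the variational inequality they differ from \<open>p\<close> by at
  most \<open>sqrt (s\<^sup>2 - |p|\<^sup>2)\<close>, and their inequality at \<open>z\<close> is the bound at these points.\<close>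
lemma excess_le_slope_gap:
  assumes s: "slope f x \<le> ereal s" and z: "crandall_pazy f \<in> subdifferential f z"
  shows "rval f x - rval f z - crandall_pazy f \<bullet> (x - z)
    \<le> sqrt (s\<^sup>2 - (norm (crandall_pazy f))\<^sup>2) * norm (x - z)"
proof -
  let ?p = "crandall_pazy f"
  let ?K = "sqrt (s\<^sup>2 - (norm ?p)\<^sup>2)"
  define d where "d n = inverse (real (Suc n))" for n
  have d: "d \<longlonglongrightarrow> 0" unfolding d_def by (rule LIMSEQ_inverse_real_of_nat)
  have "\<exists>v. v \<in> subdifferential f (x - d n *\<^sub>R v) \<and> norm v \<le> s" for n
  proof -
    have "0 < d n" by (simp add: d_def)
    from bounded_subgradient_nearby[OF s this] obtain y v where
      "v \<in> subdifferential f y" "x = y + d n *\<^sub>R v" "norm v \<le> s" .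
    then show ?thesis by (intro exI[of _ v]) simp
  qed
  then obtain V where V: "\<And>n. V n \<in> subdifferential f (x - d n *\<^sub>R V n)"
    and Vs: "\<And>n. norm (V n) \<le> s" by metis
  define Y where "Y n = x - d n *\<^sub>R V n" for n
  have V: "V n \<in> subdifferential f (Y n)" for n using V by (simp add: Y_def)
  have "(\<lambda>n. d n *\<^sub>R V n) \<longlonglongrightarrow> 0"
  proof (rule Lim_null_comparison)
    show "\<forall>\<^sub>F n in sequentially. norm (d n *\<^sub>R V n) \<le> d n * s"
      using Vs by (auto intro!: always_eventually mult_left_mono simp: d_def)
    show "(\<lambda>n. d n * s) \<longlonglongrightarrow> 0" using d by (rule tendsto_mult_left_zero)
  qed
  then have "Y \<longlonglongrightarrow> x - 0" unfolding Y_def by (intro tendsto_intros)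
  then have Yx: "Y \<longlonglongrightarrow> x" by simp
  have le: "rval f (Y n) \<le> rval f z + ?p \<bullet> (Y n - z) + ?K * norm (Y n - z)" for n
  proof -
    have "V n \<in> subdifferential_range f" using V by (auto simp: subdifferential_range_def)
    then have "(norm (V n - ?p))\<^sup>2 \<le> (norm (V n))\<^sup>2 - (norm ?p)\<^sup>2"
      by (intro norm_diff_power2_le crandall_pazy_variational)
    also have "\<dots> \<le> s\<^sup>2 - (norm ?p)\<^sup>2" using Vs[of n] by (simp add: power_mono)
    finally have K: "norm (V n - ?p) \<le> ?K" by (rule real_le_rsqrt)
    have "rval f (Y n) \<le> rval f z + V n \<bullet> (Y n - z)"
      using subdifferentialD(2)[OF V subdifferentialD(1)[OF z], of n]
      by (simp add: inner_diff_right)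
    also have "V n \<bullet> (Y n - z) = ?p \<bullet> (Y n - z) + (V n - ?p) \<bullet> (Y n - z)"
      by (simp add: inner_diff_left)
    also have "(V n - ?p) \<bullet> (Y n - z) \<le> ?K * norm (Y n - z)"
      using norm_cauchy_schwarz[of "V n - ?p" "Y n - z"] mult_right_mono[OF K, of "norm (Y n - z)"]
      by simp
    finally show ?thesis by simp
  qed
  have "(\<lambda>n. rval f z + ?p \<bullet> (Y n - z) + ?K * norm (Y n - z))
      \<longlonglongrightarrow> rval f z + ?p \<bullet> (x - z) + ?K * norm (x - z)"
    by (intro tendsto_intros Yx)
  from lsc_sequential(2)[OF Yx subdifferentialD(1)[OF V] le this] show ?thesis by simp
qed

end

section \<open>The proximal iteration\<close>

locale proximal_iteration = proper_lsc_convex f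
  for f :: "'a::{real_inner, complete_space} \<Rightarrow> ereal" +
  fixes l :: real and x v :: "nat \<Rightarrow> 'a"
  assumes l: "0 < l" and v: "\<And>n. v n \<in> subdifferential f (x n)"
    and step: "\<And>n. x n = x (Suc n) + l *\<^sub>R v (Suc n)"
begin

lemma norm_v_Suc_le: "norm (v (Suc n)) \<le> norm (v n)"
proof -
  have "0 \<le> (v n - v (Suc n)) \<bullet> (x n - x (Suc n))"
    using subdifferential_monotone[OF v v] .
  then have "0 \<le> l * ((v n - v (Suc n)) \<bullet> v (Suc n))" using step[of n] by simp
  then have "v (Suc n) \<bullet> v (Suc n) \<le> v n \<bullet> v (Suc n)"
    using l by (simp add: zero_le_mult_iff inner_diff_left)
  also have "\<dots> \<le> norm (v n) * norm (v (Suc n))" by (rule norm_cauchy_schwarz)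
  finally have "norm (v (Suc n)) * norm (v (Suc n)) \<le> norm (v n) * norm (v (Suc n))"
    by (simp flip: power2_norm_eq_inner add: power2_eq_square)
  then show ?thesis by (cases "v (Suc n) = 0") auto
qed

lemma norm_v_le: "norm (v n) \<le> norm (v 0)"
  by (induction n) (use norm_v_Suc_le order_trans in blast)+

text \<open>The points \<open>z - n l p\<close> form a proximal iteration with constant subgradient \<open>p\<close>, and resolvents
  are firmly nonexpansive. The quadratic gain on the left is summable over \<open>n\<close>, which is what makes
  the subgradients converge to \<open>p\<close>.\<close>
lemma distance_to_ray:
  assumes p: "\<And>n. p \<in> subdifferential f (z - (real n * l) *\<^sub>R p)"
  shows "(norm (x (Suc n) - (z - (real (Suc n) * l) *\<^sub>R p)))\<^sup>2 + l\<^sup>2 * (norm (v (Suc n) - p))\<^sup>2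
    \<le> (norm (x n - (z - (real n * l) *\<^sub>R p)))\<^sup>2"
proof -
  define D where "D = x (Suc n) - (z - (real (Suc n) * l) *\<^sub>R p)"
  have "x n - (z - (real n * l) *\<^sub>R p) = D + l *\<^sub>R (v (Suc n) - p)"
    unfolding D_def by (subst step) (simp add: algebra_simps)
  moreover have "0 \<le> (v (Suc n) - p) \<bullet> D"
    unfolding D_def by (rule subdifferential_monotone[OF v p])
  ultimately show ?thesis
    using l unfolding D_def[symmetric]
    by (simp add: norm_add_scaleR_power2 inner_commute[of D])
qed

lemma norm_distance_to_ray_le:
  assumes p: "\<And>n. p \<in> subdifferential f (z - (real n * l) *\<^sub>R p)"
  shows "norm (x n - (z - (real n * l) *\<^sub>R p)) \<le> norm (x 0 - z)"
proof (induction n)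
  case (Suc n)
  have "(norm (x (Suc n) - (z - (real (Suc n) * l) *\<^sub>R p)))\<^sup>2
      \<le> (norm (x n - (z - (real n * l) *\<^sub>R p)))\<^sup>2"
    using distance_to_ray[OF p, of n] zero_le_power2[of "l * norm (v (Suc n) - p)"]
    unfolding power_mult_distrib by linarith
  then show ?case using Suc power2_le_imp_le norm_ge_zero order_trans by blast
qed simp

lemma v_tendsto:
  assumes p: "\<And>n. p \<in> subdifferential f (z - (real n * l) *\<^sub>R p)"
  shows "v \<longlonglongrightarrow> p"
proof -
  define a where "a n = (norm (x n - (z - (real n * l) *\<^sub>R p)))\<^sup>2" for n
  have a: "l\<^sup>2 * (norm (v (Suc n) - p))\<^sup>2 \<le> a n - a (Suc n)" for n
    using distance_to_ray[OF p, of n] by (simp add: a_def)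
  have "a (Suc n) \<le> a n" for n
  proof -
    have "0 \<le> l\<^sup>2 * (norm (v (Suc n) - p))\<^sup>2" by simp
    with a[of n] show ?thesis by linarith
  qed
  moreover have "0 \<le> a n" for n by (simp add: a_def)
  ultimately have "(\<lambda>n. a n - a (Suc n)) \<longlonglongrightarrow> 0" by (rule decseq_increments_tendsto_0)
  then have "(\<lambda>n. (a n - a (Suc n)) / l\<^sup>2) \<longlonglongrightarrow> 0" by (rule tendsto_divide_zero)
  moreover have bound: "(norm (v (Suc n) - p))\<^sup>2 \<le> (a n - a (Suc n)) / l\<^sup>2" for n
    using a[of n] l by (simp add: pos_le_divide_eq mult.commute)
  ultimately have "(\<lambda>n. v (Suc n)) \<longlonglongrightarrow> p"
    by (intro tendsto_if_norm_power2_le[OF bound])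
  then show ?thesis by (rule LIMSEQ_imp_Suc)
qed

end

context proper_lsc_convex
begin

lemma proximal_iteration_exists:
  assumes l: "0 < l" and v0: "v0 \<in> subdifferential f x0"
  obtains x v where "proximal_iteration f l x v" and "x 0 = x0" and "v 0 = v0"
proof -
  have "\<exists>w. w \<in> subdifferential f (y - l *\<^sub>R w)" for y
  proof -
    from resolvent_exists[OF l, where x = y] obtain u w where
      "w \<in> subdifferential f u" "y = u + l *\<^sub>R w" .
    then show ?thesis by (intro exI[of _ w]) simp
  qed
  then obtain W where W: "\<And>y. W y \<in> subdifferential f (y - l *\<^sub>R W y)" by metis
  define x where "x n = ((\<lambda>y. y - l *\<^sub>R W y) ^^ n) x0" for n
  define v where "v n = (case n of 0 \<Rightarrow> v0 | Suc k \<Rightarrow> W (x k))" for n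
  have Suc: "x (Suc n) = x n - l *\<^sub>R v (Suc n)" for n by (simp add: x_def v_def)
  show thesis
  proof (rule that)
    show "proximal_iteration f l x v"
    proof
      show "v n \<in> subdifferential f (x n)" for n
        using v0 W by (cases n) (simp_all add: x_def v_def)
      show "x n = x (Suc n) + l *\<^sub>R v (Suc n)" for n by (simp add: Suc)
    qed (rule l)
  qed (simp_all add: x_def v_def)
qed

end

section \<open>Comparison of two functions with equal slopes\<close>

text \<open>One step costs at most \<open>l |v\<^sub>n\<^sub>+\<^sub>1| (|v\<^sub>n| - |v\<^sub>n\<^sub>+\<^sub>1|)\<close>, because the slope of \<open>g\<close> at \<open>x\<^sub>n\<close> is at most
  \<open>|v\<^sub>n|\<close>; bounding the first factor by \<open>|v\<^sub>0|\<close> makes the sum of the costs telescope.\<close>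
lemma difference_drop_along_iteration:
  assumes it: "proximal_iteration f l x v" and g: "proper_lsc_convex g"
    and slope: "\<And>y. slope f y = slope g y"
  shows "rval f (x n) - rval g (x n) - l * norm (v 0) * (norm (v 0) - norm (v n))
    \<le> rval f (x 0) - rval g (x 0)"
proof -
  interpret f: proximal_iteration f l x v by (rule it)
  interpret g: proper_lsc_convex g by (rule g)
  have sg: "slope g (x n) \<le> ereal (norm (v n))" for n
    using f.slope_le_norm_subgradient[OF f.v[of n]] by (simp add: slope)
  show ?thesis
  proof (induction n)
    case (Suc n)
    let ?a = "norm (v n)" and ?b = "norm (v (Suc n))"
    have diff: "x n - x (Suc n) = l *\<^sub>R v (Suc n)" using f.step[of n] by simp
    have "rval f (x (Suc n)) + v (Suc n) \<bullet> (x n - x (Suc n)) \<le> rval f (x n)"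
      using f.subdifferentialD[OF f.v] by blast
    then have F: "l * ?b\<^sup>2 \<le> rval f (x n) - rval f (x (Suc n))"
      by (simp add: diff power2_norm_eq_inner)
    have "rval g (x n) - rval g (x (Suc n)) \<le> ?a * norm (x n - x (Suc n))"
      using g.diff_le_slope[OF sg g.slope_finite_edom[OF sg]] .
    then have G: "rval g (x n) - rval g (x (Suc n)) \<le> l * (?a * ?b)"
      using f.l by (simp add: diff mult.left_commute)
    have "(l * (?a - ?b)) * ?b \<le> (l * (?a - ?b)) * norm (v 0)"
      using f.l f.norm_v_Suc_le[of n] f.norm_v_le[of "Suc n"] by (intro mult_left_mono) auto
    then show ?case using Suc F G by (simp add: algebra_simps power2_eq_square)
  qed simp
qed

text \<open>For a fixed step size the number of steps tends to infinity, which removes the contribution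
  of the end point; then the step size tends to zero, which removes the discretisation error
  \<open>l |v\<^sub>0|\<^sup>2\<close>.\<close>
lemma rval_diff_le_at_subgradient:
  assumes f: "proper_lsc_convex f" and g: "proper_lsc_convex g"
    and slope: "\<And>y. slope f y = slope g y"
    and cp: "crandall_pazy f = crandall_pazy g"
    and z: "slope f z \<le> ereal (norm (crandall_pazy f))"
    and v0: "v0 \<in> subdifferential f x0"
  shows "rval g x0 - rval g z \<le> rval f x0 - rval f z"
proof -
  interpret f: proper_lsc_convex f by (rule f)
  interpret g: proper_lsc_convex g by (rule g)
  let ?p = "crandall_pazy f"
  have z': "slope g z \<le> ereal (norm (crandall_pazy g))" using z by (simp add: slope cp)
  have bound: "(rval f z - rval g z) - (rval f x0 - rval g x0) \<le> l * (norm v0)\<^sup>2"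
    if l: "0 < l" for l
  proof -
    from f.proximal_iteration_exists[OF l v0] obtain x v where
      it: "proximal_iteration f l x v" and x0: "x 0 = x0" and v0: "v 0 = v0" .
    interpret it: proximal_iteration f l x v by (rule it)
    define r where "r n = z - (real n * l) *\<^sub>R ?p" for n
    have fr: "?p \<in> subdifferential f (r n)" for n
      unfolding r_def using l by (intro f.crandall_pazy_along_ray[OF z]) simp
    have gr: "?p \<in> subdifferential g (r n)" for n
      unfolding r_def cp using l by (intro g.crandall_pazy_along_ray[OF z']) simp
    have same: "rval f (r n) - rval g (r n) = rval f z - rval g z" for n
    proof -
      have r0: "r 0 = z" by (simp add: r_def)
      have 1: "rval f z + ?p \<bullet> (r n - z) \<le> rval f (r n)" "rval f (r n) + ?p \<bullet> (z - r n) \<le> rval f z"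
        using f.subdifferentialD[OF fr] r0 by metis+
      have 2: "rval g z + ?p \<bullet> (r n - z) \<le> rval g (r n)" "rval g (r n) + ?p \<bullet> (z - r n) \<le> rval g z"
        using g.subdifferentialD[OF gr] r0 by metis+
      have "?p \<bullet> (z - r n) = - (?p \<bullet> (r n - z))" by (simp add: inner_diff_right)
      with 1 2 show ?thesis by linarith
    qed
    define K where "K n = sqrt ((norm (v n))\<^sup>2 - (norm ?p)\<^sup>2)" for n
    have ray: "?p \<in> subdifferential f (z - (real n * l) *\<^sub>R ?p)" for n
      using fr by (simp add: r_def)
    have main: "(rval f z - rval g z) - (rval f x0 - rval g x0)
        \<le> l * (norm v0)\<^sup>2 + K n * norm (x0 - z)" for n
    proof -
      have sg: "slope g (x n) \<le> ereal (norm (v n))"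
        using f.slope_le_norm_subgradient[OF it.v[of n]] by (simp add: slope)
      have F: "rval f (r n) + ?p \<bullet> (x n - r n) \<le> rval f (x n)"
        using f.subdifferentialD(2)[OF fr f.subdifferentialD(1)[OF it.v]] .
      have "rval g (x n) - rval g (r n) - ?p \<bullet> (x n - r n) \<le> K n * norm (x n - r n)"
        using g.excess_le_slope_gap[OF sg, of "r n"] gr by (simp add: cp K_def)
      also have "\<dots> \<le> K n * norm (x0 - z)"
      proof (rule mult_left_mono)
        show "norm (x n - r n) \<le> norm (x0 - z)"
          using it.norm_distance_to_ray_le[OF ray, of n] by (simp add: r_def x0)
        have "?p \<bullet> v n \<le> norm ?p * norm (v n)" by (rule norm_cauchy_schwarz)
        moreover have "(norm ?p)\<^sup>2 \<le> ?p \<bullet> v n"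
          using it.v by (intro f.crandall_pazy_variational) (auto simp: subdifferential_range_def)
        ultimately have "norm ?p * norm ?p \<le> norm ?p * norm (v n)"
          by (simp add: power2_eq_square)
        then have "norm ?p \<le> norm (v n)" by (cases "?p = 0") auto
        then show "0 \<le> K n" by (simp add: K_def power_mono)
      qed
      finally have G: "rval g (x n) - rval g (r n) - ?p \<bullet> (x n - r n) \<le> K n * norm (x0 - z)" .
      have "rval f (x n) - rval g (x n) - l * norm v0 * (norm v0 - norm (v n))
          \<le> rval f x0 - rval g x0"
        using difference_drop_along_iteration[OF it g slope, of n] by (simp add: x0 v0)
      moreover have "l * norm v0 * (norm v0 - norm (v n)) \<le> l * (norm v0)\<^sup>2"
        using l by (simp add: power2_eq_square algebra_simps)
      ultimately show ?thesis using F G same[of n] by linarith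
    qed
    have "K \<longlonglongrightarrow> sqrt ((norm ?p)\<^sup>2 - (norm ?p)\<^sup>2)"
      unfolding K_def by (intro tendsto_intros it.v_tendsto[OF ray])
    then have "(\<lambda>n. l * (norm v0)\<^sup>2 + K n * norm (x0 - z)) \<longlonglongrightarrow> l * (norm v0)\<^sup>2 + 0 * norm (x0 - z)"
      by (intro tendsto_intros) simp
    then show ?thesis
      using LIMSEQ_le_const[of _ "l * (norm v0)\<^sup>2 + 0 * norm (x0 - z)"] main by auto
  qed
  have "(rval f z - rval g z) - (rval f x0 - rval g x0) \<le> 0"
  proof (rule tendsto_lowerbound)
    show "((\<lambda>l. l * (norm v0)\<^sup>2) \<longlongrightarrow> 0) (at_right 0)"
      by (intro tendsto_mult_left_zero tendsto_ident_at)
    show "\<forall>\<^sub>F l in at_right 0. (rval f z - rval g z) - (rval f x0 - rval g x0) \<le> l * (norm v0)\<^sup>2"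
      using bound unfolding eventually_at_right_field by (intro exI[of _ 1]) simp
  qed simp
  then show ?thesis by simp
qed

text \<open>Points of the effective domain need not have subgradients; their resolvents do, and
  converge to them as the parameter tends to zero.\<close>
lemma (in proper_lsc_convex) resolvents_approximate:
  assumes x: "x \<in> edom f"
  shows "\<exists>Y V. (\<forall>n. V n \<in> subdifferential f (Y n)) \<and> (\<forall>n. rval f (Y n) \<le> rval f x)
    \<and> Y \<longlonglongrightarrow> x"
proof -
  define d where "d n = inverse (real (Suc n))" for n
  have d: "d \<longlonglongrightarrow> 0" unfolding d_def by (rule LIMSEQ_inverse_real_of_nat)
  have dpos: "0 < d n" for n by (simp add: d_def)
  have "\<exists>v. v \<in> subdifferential f (x - d n *\<^sub>R v)" for n
  proof -
    from resolvent_exists[OF dpos, where x = x] obtain y v where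
      "v \<in> subdifferential f y" "x = y + d n *\<^sub>R v" .
    then show ?thesis by (intro exI[of _ v]) simp
  qed
  then obtain V where V: "\<And>n. V n \<in> subdifferential f (x - d n *\<^sub>R V n)" by metis
  define Y where "Y n = x - d n *\<^sub>R V n" for n
  have VY: "V n \<in> subdifferential f (Y n)" for n using V by (simp add: Y_def)
  have decay: "d n * (norm (V n))\<^sup>2 \<le> rval f x - rval f (Y n)" for n
    using subdifferentialD(2)[OF VY[of n] x] by (simp add: Y_def power2_norm_eq_inner)
  obtain a b where b: "b \<ge> 0" and ab: "\<And>y. y \<in> edom f \<Longrightarrow> a - b * norm (y - x) \<le> rval f y"
    using linear_minorant[of x] by auto
  define C where "C = rval f x - a"
  have "(d n * norm (V n))\<^sup>2 \<le> 2 * C * d n + b\<^sup>2 * (d n)\<^sup>2" for n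
  proof -
    define q where "q = d n * norm (V n)"
    have "norm (Y n - x) = q" using dpos[of n] by (simp add: Y_def q_def)
    then have "d n * (norm (V n))\<^sup>2 \<le> C + b * q"
      using decay[of n] ab[OF subdifferentialD(1)[OF VY], of n] by (simp add: C_def)
    then have "d n * (d n * (norm (V n))\<^sup>2) \<le> d n * (C + b * q)"
      using dpos[of n] by (intro mult_left_mono) auto
    then have "q\<^sup>2 \<le> d n * (C + b * q)" by (simp add: q_def power2_eq_square ac_simps)
    \<comment> \<open>Absorbs the cross term: \<open>2 b q d \<le> q\<^sup>2 + b\<^sup>2 d\<^sup>2\<close>.\<close>
    moreover have "0 \<le> (q - b * d n)\<^sup>2" by simp
    ultimately show ?thesis unfolding q_def[symmetric]
      by (simp add: power2_eq_square algebra_simps)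
  qed
  then have sq: "(norm (Y n - x))\<^sup>2 \<le> 2 * C * d n + b\<^sup>2 * (d n)\<^sup>2" for n
    using dpos[of n] by (simp add: Y_def power_mult_distrib)
  have "(\<lambda>n. 2 * C * d n + b\<^sup>2 * (d n)\<^sup>2) \<longlonglongrightarrow> 2 * C * 0 + b\<^sup>2 * 0\<^sup>2"
    by (intro tendsto_intros d)
  then have "(\<lambda>n. 2 * C * d n + b\<^sup>2 * (d n)\<^sup>2) \<longlonglongrightarrow> 0" by simp
  with sq have "Y \<longlonglongrightarrow> x" by (rule tendsto_if_norm_power2_le)
  moreover have "rval f (Y n) \<le> rval f x" for n
  proof -
    have "0 \<le> d n * (norm (V n))\<^sup>2" using dpos[of n] by simp
    with decay[of n] show ?thesis by linarith
  qed
  ultimately show ?thesis using VY by blast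
qed

lemma rval_diff_le:
  assumes f: "proper_lsc_convex f" and g: "proper_lsc_convex g"
    and slope: "\<And>y. slope f y = slope g y"
    and cp: "crandall_pazy f = crandall_pazy g"
    and z: "slope f z \<le> ereal (norm (crandall_pazy f))"
    and x: "x \<in> edom f"
  shows "x \<in> edom g" and "rval g x - rval g z \<le> rval f x - rval f z"
proof -
  interpret f: proper_lsc_convex f by (rule f)
  interpret g: proper_lsc_convex g by (rule g)
  obtain Y V where V: "\<And>n. V n \<in> subdifferential f (Y n)"
    and Y: "\<And>n. rval f (Y n) \<le> rval f x" and lim: "Y \<longlonglongrightarrow> x"
    using f.resolvents_approximate[OF x] by metis
  have dom: "Y n \<in> edom g" for n
    using f.slope_le_norm_subgradient[OF V[of n]] g.slope_finite_edom by (simp add: slope)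
  have le: "rval g (Y n) \<le> rval f x - rval f z + rval g z" for n
    using rval_diff_le_at_subgradient[OF f g slope cp z V, of n] Y[of n] by linarith
  show "x \<in> edom g" using g.lsc_sequential(1)[OF lim dom le tendsto_const] .
  show "rval g x - rval g z \<le> rval f x - rval f z"
    using g.lsc_sequential(2)[OF lim dom le tendsto_const] by simp
qed

theorem proposition4p1:
  fixes f g :: "'a::{real_inner, complete_space} \<Rightarrow> ereal"
  assumes "proper_fun f" and "lsc_fun f" and "convex_fun f"
    and "proper_fun g" and "lsc_fun g" and "convex_fun g"
    and "\<And>x. slope f x = slope g x"
    and "crandall_pazy f = crandall_pazy g"
    and "crandall_pazy f \<in> subdifferential_range f"
  shows "\<exists>c::real. \<forall>x. f x = g x + ereal c"
proof -
  interpret f: proper_lsc_convex f using assms by unfold_locales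
  interpret g: proper_lsc_convex g using assms by unfold_locales
  obtain z where "crandall_pazy f \<in> subdifferential f z"
    using assms(9) by (auto simp: subdifferential_range_def)
  then have zf: "slope f z \<le> ereal (norm (crandall_pazy f))"
    by (rule f.slope_le_norm_subgradient)
  then have zg: "slope g z \<le> ereal (norm (crandall_pazy g))" by (simp add: assms(7,8))
  note fg = rval_diff_le[OF f.proper_lsc_convex_axioms g.proper_lsc_convex_axioms assms(7,8) zf]
  note gf = rval_diff_le[OF g.proper_lsc_convex_axioms f.proper_lsc_convex_axioms
    assms(7)[symmetric] assms(8)[symmetric] zg]
  have "f x = g x + ereal (rval f z - rval g z)" for x
  proof (cases "x \<in> edom f")
    case True
    then show ?thesis using fg[OF True] gf(2)[of x] f.ereal_rval[of x] g.ereal_rval[of x] by simp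
  next
    case False
    then have "x \<notin> edom g" using gf(1) by blast
    then show ?thesis using False by (simp add: edom_def)
  qed
  then show ?thesis by blast
qed

end
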